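(* Let $n\ge 1$. The minimal number of generators of $G_n$ as a closed group is $n+1$; that is, $n+1$ is the smallest cardinality of a subset $S\subseteq G_n$ such that the subgroup generated by $S$ is dense in $G_n$.
   Context: $G_n$ is the matrix Lie group $\left\{\begin{pmatrix} a & \mathbf b\\ 0 & I_n\end{pmatrix} : \mathbf b\in\mathbb{R}^n,\ a>0\right\}$. Replacing the coordinate $a$ by its natural logarithm, $G_n$ is identified with $\mathbb{R}\times\mathbb{R}^n$ with product $(a,\mathbf b)(a',\mathbf b')=(a+a',\mathbf b+e^{a}\mathbf b')$. *)

theory Defs
  imports "HOL-Analysis.Analysis" "HOL-Algebra.Generated_Groups"
begin

text \<open>The dimension \<open>n\<close> is \<open>CARD('n)\<close>, so \<open>n \<ge> 1\<close> is automatic. Matrices of size \<open>n + 1\<close> are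
  indexed by \<open>'n option\<close>, where \<open>None\<close> is the index of the first row and column; the vector
  \<open>b\<close> is the remainder of the first row.\<close>

definition block_mat :: "real \<Rightarrow> real ^ 'n::finite \<Rightarrow> real ^ ('n option) ^ ('n option)" where
  "block_mat a b = (\<chi> i j. case i of
       None \<Rightarrow> (case j of None \<Rightarrow> a | Some l \<Rightarrow> b $ l)
     | Some k \<Rightarrow> (case j of None \<Rightarrow> 0 | Some l \<Rightarrow> if k = l then 1 else 0))"

definition Gn :: "(real ^ ('n::finite option) ^ ('n option)) monoid" where
  "Gn = \<lparr>carrier = {block_mat a b | a b. a > 0}, mult = (**), one = mat 1\<rparr>"

text \<open>Density is taken in the subspace topology that \<open>Gn\<close> inherits from the space of matrices,
  in which \<open>Gn\<close> is not closed.\<close>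

definition generates_densely :: "(real ^ ('n::finite option) ^ ('n option)) set \<Rightarrow> bool" where
  "generates_densely S \<longleftrightarrow>
     top_of_set (carrier Gn) closure_of (generate Gn S) = carrier Gn"

lemma sum_option: "(\<Sum>k\<in>UNIV. f k) = f None + (\<Sum>k\<in>UNIV. f (Some k))"
  for f :: "'n::finite option \<Rightarrow> real"
  by (simp add: UNIV_option_conv sum.reindex)

lemma block_mat_mult:
  "block_mat a b ** block_mat a' b' = block_mat (a * a') (b + a *\<^sub>R b')"
  by (simp add: block_mat_def matrix_matrix_mult_def vec_eq_iff sum_option sum.delta
      mult_delta_left mult_delta_right split: option.split)

lemma block_mat_one: "block_mat 1 0 = mat 1"
  by (simp add: block_mat_def mat_def vec_eq_iff split: option.split)

lemma group_Gn: "group (Gn :: (real ^ ('n::finite option) ^ ('n option)) monoid)"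
proof (rule groupI)
  fix x :: "real ^ ('n option) ^ ('n option)" assume "x \<in> carrier Gn"
  then obtain a b where x: "x = block_mat a b" "a > 0" by (auto simp: Gn_def)
  have "block_mat (1/a) (- ((1/a) *\<^sub>R b)) \<otimes>\<^bsub>Gn\<^esub> x = \<one>\<^bsub>Gn\<^esub>"
    using x by (simp add: Gn_def block_mat_mult block_mat_one)
  moreover have "block_mat (1/a) (- ((1/a) *\<^sub>R b)) \<in> carrier Gn"
    using x by (auto simp: Gn_def intro!: exI)
  ultimately show "\<exists>y\<in>carrier Gn. y \<otimes>\<^bsub>Gn\<^esub> x = \<one>\<^bsub>Gn\<^esub>" by blast
next
  show "\<one>\<^bsub>Gn\<^esub> \<in> carrier (Gn :: (real ^ ('n option) ^ ('n option)) monoid)"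
    unfolding Gn_def by (auto simp flip: block_mat_one intro!: exI)
qed (auto simp: Gn_def block_mat_mult matrix_mul_assoc, use mult_pos_pos in metis)

text \<open>In the coordinate \<open>ln a\<close> the product is \<open>(a, b) (a', b') = (a + a', b + exp a b')\<close>.\<close>

lemma block_mat_exp_mult:
  "block_mat (exp a) b \<otimes>\<^bsub>Gn\<^esub> block_mat (exp a') b' = block_mat (exp (a + a')) (b + exp a *\<^sub>R b')"
  by (simp add: Gn_def block_mat_mult exp_add)

end

theory Submission
  imports Defs
begin

text \<open>Write \<open>(a, b)\<close> for \<open>block_mat a b\<close>, so that \<open>(a, b) (a', b') = (a a', b + a b')\<close>.

  Fewer than \<open>n + 1\<close> elements never suffice. The map \<open>c (a, b) = (a - 1, b)\<close> into the space of
  dimension \<open>n + 1\<close> satisfies \<open>c (g h) = c g + a c h\<close>, where \<open>a\<close> is the corner entry of \<open>g\<close>.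
  Hence for every vector \<open>w\<close> the elements with \<open>w \<bullet> c g = 0\<close> form a closed subgroup, which is
  proper if \<open>w \<noteq> 0\<close>. At most \<open>n\<close> vectors \<open>c g\<close> leave room for a nonzero \<open>w\<close> orthogonal to them
  all, so any set of at most \<open>n\<close> elements lies in such a proper closed subgroup. This treats the subgroup of translations
  (\<open>w\<close> the first unit vector) and the stabilisers of affine hyperplanes of \<open>\<real>\<^sup>n\<close> together.

  On the other hand, the \<open>n + 1\<close> elements \<open>(2, 0)\<close> and \<open>(2\<^sup>s, e\<^sub>k)\<close> with \<open>s = sqrt 2\<close> generate a
  dense subgroup \<open>H\<close>. The commutator of \<open>(2, 0)\<close> with \<open>(2\<^sup>s, e\<^sub>k)\<close> is the translation
  \<open>(1, e\<^sub>k)\<close>, so \<open>(2\<^sup>s, 0) \<in> H\<close> as well. The reals \<open>d\<close> with \<open>(1, d e\<^sub>k) \<in> H\<close> form an additive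
  group closed under halving, as conjugation with \<open>(2, 0)\<close> scales translations; the reals \<open>t\<close>
  with \<open>(2\<^sup>t, 0) \<in> H\<close> form an additive group containing \<open>1\<close> and \<open>s\<close>, hence all powers of
  \<open>s - 1\<close>. Both groups contain arbitrarily small positive numbers and so are dense in \<open>\<real>\<close>, and
  the products \<open>(1, b) (2\<^sup>t, 0) = (2\<^sup>t, b)\<close> approximate every element of the group.\<close>

section \<open>Block matrices and their subgroups\<close>

lemma block_mat_nth [simp]:
  "block_mat a b $ None $ None = a"
  "block_mat a b $ None $ Some k = b $ k"
  by (simp_all add: block_mat_def)

lemma block_mat_eq_iff: "block_mat a b = block_mat a' b' \<longleftrightarrow> a = a' \<and> b = b'"
proof
  assume eq: "block_mat a b = block_mat a' b'"
  have "b $ k = b' $ k" for k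
    using arg_cong[OF eq, of "\<lambda>M. M $ None $ Some k"] by simp
  with arg_cong[OF eq, of "\<lambda>M. M $ None $ None"] show "a = a' \<and> b = b'"
    by (simp add: vec_eq_iff)
qed simp

lemma block_mat_in_carrier_iff: "block_mat a b \<in> carrier Gn \<longleftrightarrow> a > 0"
  by (auto simp: Gn_def block_mat_eq_iff)

lemma carrier_GnE:
  assumes "x \<in> carrier Gn"
  obtains a b where "x = block_mat a b" "a > 0"
  using assms by (auto simp: Gn_def)

lemma Gn_mult: "block_mat a b \<otimes>\<^bsub>Gn\<^esub> block_mat a' b' = block_mat (a * a') (b + a *\<^sub>R b')"
  by (simp add: Gn_def block_mat_mult)

lemma Gn_one: "\<one>\<^bsub>Gn\<^esub> = block_mat 1 0"
  by (simp add: Gn_def block_mat_one)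

lemma Gn_inv:
  assumes "a > 0"
  shows "inv\<^bsub>Gn\<^esub> (block_mat a b) = block_mat (1 / a) (- ((1 / a) *\<^sub>R b))"
  using assms
  by (intro group.inv_equality[OF group_Gn])
     (simp_all add: Gn_mult Gn_one block_mat_in_carrier_iff)

lemma subgroup_Gn_mult:
  assumes "subgroup H Gn" "block_mat a b \<in> H" "block_mat a' b' \<in> H"
  shows "block_mat (a * a') (b + a *\<^sub>R b') \<in> H"
  using subgroup.m_closed[OF assms] by (simp add: Gn_mult)

lemma subgroup_Gn_inv:
  assumes "subgroup H Gn" "block_mat a b \<in> H"
  shows "block_mat (1 / a) (- ((1 / a) *\<^sub>R b)) \<in> H"
proof -
  have "a > 0"
    using subgroup.mem_carrier[OF assms] by (simp add: block_mat_in_carrier_iff)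
  then show ?thesis
    using subgroup.m_inv_closed[OF assms] by (simp add: Gn_inv)
qed

lemma subgroup_Gn_translation_diff:
  assumes "subgroup H Gn" "block_mat 1 b \<in> H" "block_mat 1 b' \<in> H"
  shows "block_mat 1 (b - b') \<in> H"
  using subgroup_Gn_mult[OF assms(1,2) subgroup_Gn_inv[OF assms(1,3)]] by simp

section \<open>At least \<open>n + 1\<close> generators\<close>

text \<open>The first row of a block matrix minus that of the identity is a crossed homomorphism for
  the scaling action through the corner entry, and scaling preserves the hyperplane orthogonal
  to \<open>w\<close>.\<close>

lemma subgroup_hyperplane:
  fixes w :: "real ^ ('n::finite option)"
  shows "subgroup {M \<in> carrier Gn. w \<bullet> (M $ None - axis None 1) = 0} Gn" (is "subgroup ?K Gn")
proof -
  have c: "w \<bullet> (block_mat a b $ None - axis None 1) = w $ None * (a - 1) + (\<Sum>k\<in>UNIV. w $ Some k * b $ k)"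
    for a and b :: "real ^ 'n"
    by (simp add: inner_vec_def sum_option axis_def)
  have mult: "w \<bullet> (block_mat (a * a') (b + a *\<^sub>R b') $ None - axis None 1)
      = w \<bullet> (block_mat a b $ None - axis None 1) + a * (w \<bullet> (block_mat a' b' $ None - axis None 1))"
    for a a' and b b' :: "real ^ 'n"
    unfolding c by (simp add: algebra_simps sum.distrib sum_distrib_left)
  have one: "w \<bullet> (block_mat 1 0 $ None - axis None 1) = 0"
    by (simp add: c)
  show ?thesis
  proof (rule group.subgroupI[OF group_Gn])
    show "?K \<noteq> {}"
      using one by (auto simp: block_mat_in_carrier_iff intro!: exI[of _ "block_mat 1 0"])
  next
    fix x assume "x \<in> ?K"
    then obtain a b where x: "x = block_mat a b" "a > 0"
        "w \<bullet> (block_mat a b $ None - axis None 1) = 0"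
      by (auto elim: carrier_GnE)
    have "block_mat (1 / a * a) (- ((1 / a) *\<^sub>R b) + (1 / a) *\<^sub>R b) = block_mat 1 0"
      using x by simp
    with one mult[of "1 / a" a "- ((1 / a) *\<^sub>R b)" b] x(3)
    have "w \<bullet> (block_mat (1 / a) (- ((1 / a) *\<^sub>R b)) $ None - axis None 1) = 0"
      by simp
    with x show "inv\<^bsub>Gn\<^esub> x \<in> ?K"
      by (simp add: Gn_inv block_mat_in_carrier_iff)
  next
    fix x y assume "x \<in> ?K" "y \<in> ?K"
    then obtain a b a' b' where xy: "x = block_mat a b" "a > 0" "y = block_mat a' b'" "a' > 0"
        "w \<bullet> (block_mat a b $ None - axis None 1) = 0"
        "w \<bullet> (block_mat a' b' $ None - axis None 1) = 0"
      by (auto elim!: carrier_GnE)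
    with mult[of a a' b b'] show "x \<otimes>\<^bsub>Gn\<^esub> y \<in> ?K"
      by (simp add: Gn_mult block_mat_in_carrier_iff)
  qed auto
qed

lemma hyperplane_eq_carrier_imp_zero:
  fixes w :: "real ^ ('n::finite option)"
  assumes "\<And>M. M \<in> carrier Gn \<Longrightarrow> w \<bullet> (M $ None - axis None 1) = 0"
  shows "w = 0"
proof -
  have row: "w $ None * (a - 1) + (\<Sum>k\<in>UNIV. w $ Some k * b $ k) = 0"
    if "a > 0" for a and b :: "real ^ 'n"
    using assms[of "block_mat a b"] that
    by (simp add: block_mat_in_carrier_iff inner_vec_def sum_option axis_def)
  have "w $ None = 0"
    using row[of 2 0] by simp
  moreover have "w $ Some k = 0" for k
    using row[of 1 "axis k 1"] by (simp add: axis_def if_distrib cong: if_cong)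
  ultimately have "w $ i = 0" for i
    by (cases i) auto
  then show ?thesis
    by (simp add: vec_eq_iff)
qed

text \<open>A dense subgroup contained in a closed one forces the latter to be everything.\<close>

lemma generates_densely_subgroup:
  assumes "generates_densely S" "S \<subseteq> K" "subgroup K Gn" "closedin (top_of_set (carrier Gn)) K"
  shows "K = carrier Gn"
proof -
  have "generate Gn S \<subseteq> K"
    using assms(2,3) by (rule group.generate_subgroup_incl[OF group_Gn])
  then have "top_of_set (carrier Gn) closure_of generate Gn S \<subseteq> K"
    using assms(4) by (rule closure_of_minimal)
  with assms(1) subgroup.subset[OF assms(3)] show ?thesis
    by (auto simp: generates_densely_def)
qed

lemma card_generators_ge:
  fixes S :: "(real ^ ('n::finite option) ^ ('n option)) set"
  assumes "S \<subseteq> carrier Gn" "finite S" "generates_densely S"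
  shows "CARD('n) + 1 \<le> card S"
proof (rule ccontr)
  let ?c = "\<lambda>M :: real ^ ('n option) ^ ('n option). M $ None - axis None 1"
  assume "\<not> CARD('n) + 1 \<le> card S"
  then have "card (?c ` S) < DIM(real ^ ('n option))"
    using card_image_le[OF assms(2), of ?c] by simp
  then have "dim (?c ` S) < DIM(real ^ ('n option))"
    using dim_le_card'[of "?c ` S"] assms(2) by simp
  then obtain w where w: "w \<noteq> 0" "\<And>v. v \<in> span (?c ` S) \<Longrightarrow> orthogonal w v"
    using orthogonal_to_subspace_exists by blast
  define K where "K = {M \<in> carrier Gn. w \<bullet> ?c M = 0}"
  have "S \<subseteq> K"
    using assms(1) w(2) by (auto simp: K_def orthogonal_def span_base)
  moreover have "subgroup K Gn"
    unfolding K_def by (rule subgroup_hyperplane)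
  moreover have "closedin (top_of_set (carrier Gn)) K"
  proof -
    have "closed {M. w \<bullet> ?c M = 0}"
      by (intro closed_Collect_eq continuous_intros)
    then show ?thesis
      unfolding K_def by (auto simp: closedin_closed)
  qed
  ultimately have "K = carrier Gn"
    by (intro generates_densely_subgroup[OF assms(3)])
  then have "w = 0"
    by (intro hyperplane_eq_carrier_imp_zero) (auto simp: K_def)
  with w(1) show False
    by simp
qed

section \<open>Dense additive groups of reals\<close>

lemma additive_group_of_int_mult:
  fixes D :: "real set"
  assumes zero: "0 \<in> D" and diff: "\<And>x y. x \<in> D \<Longrightarrow> y \<in> D \<Longrightarrow> x - y \<in> D" and "d \<in> D"
  shows "of_int m * d \<in> D"
proof -
  have neg: "- x \<in> D" if "x \<in> D" for x
    using diff[OF zero that] by simp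
  show ?thesis
  proof (induction m rule: int_induct[where k = 0])
    case (step1 i)
    then show ?case
      using diff[OF step1(2) neg[OF \<open>d \<in> D\<close>]] by (simp add: algebra_simps)
  next
    case (step2 i)
    then show ?case
      using diff[OF step2(2) \<open>d \<in> D\<close>] by (simp add: algebra_simps)
  qed (simp add: zero)
qed

lemma dense_additive_group:
  fixes D :: "real set"
  assumes "0 \<in> D" "\<And>x y. x \<in> D \<Longrightarrow> y \<in> D \<Longrightarrow> x - y \<in> D"
    and small: "\<And>e. e > 0 \<Longrightarrow> \<exists>d\<in>D. 0 < d \<and> d < e"
  shows "closure D = UNIV"
proof -
  have "\<exists>y\<in>D. dist y x < e" if "e > 0" for x e
  proof -
    from small[OF that] obtain d where d: "d \<in> D" "0 < d" "d < e"
      by blast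
    \<comment> \<open>The multiple of \<open>d\<close> just below \<open>x\<close> is closer to \<open>x\<close> than \<open>d\<close>.\<close>
    define m where "m = \<lfloor>x / d\<rfloor>"
    have "of_int m \<le> x / d" "x / d < of_int m + 1"
      by (simp_all add: m_def)
    then have "of_int m * d \<le> x" "x < of_int m * d + d"
      using d(2) by (simp_all add: field_simps)
    then have "dist (of_int m * d) x < e"
      using d(3) by (simp add: dist_real_def)
    with additive_group_of_int_mult[OF assms(1,2) d(1)] show ?thesis
      by blast
  qed
  then show ?thesis
    by (auto simp: closure_approachable)
qed

text \<open>Halving a fixed element repeatedly gives arbitrarily small ones.\<close>

lemma dense_additive_group_halving:
  fixes D :: "real set"
  assumes "0 \<in> D" "\<And>x y. x \<in> D \<Longrightarrow> y \<in> D \<Longrightarrow> x - y \<in> D"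
    and "1 \<in> D" and half: "\<And>x. x \<in> D \<Longrightarrow> x / 2 \<in> D"
  shows "closure D = UNIV"
proof (rule dense_additive_group[OF assms(1,2)])
  fix e :: real assume "e > 0"
  then obtain j where j: "(1 / 2 :: real) ^ j < e"
    using real_arch_pow_inv[of e "1 / 2"] by auto
  have "(1 / 2) ^ j \<in> D"
    by (induction j) (use \<open>1 \<in> D\<close> half in auto)
  with j show "\<exists>d\<in>D. 0 < d \<and> d < e"
    by (intro bexI[of _ "(1 / 2) ^ j"]) auto
qed auto

text \<open>The powers of \<open>sqrt 2 - 1\<close> tend to zero, and they are integral combinations of \<open>1\<close> and
  \<open>sqrt 2\<close>.\<close>

lemma dense_additive_group_sqrt2:
  fixes D :: "real set"
  assumes "0 \<in> D" and diff: "\<And>x y. x \<in> D \<Longrightarrow> y \<in> D \<Longrightarrow> x - y \<in> D"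
    and "1 \<in> D" "sqrt 2 \<in> D"
  shows "closure D = UNIV"
proof (rule dense_additive_group[OF assms(1,2)])
  fix e :: real assume "e > 0"
  define u :: real where "u = sqrt 2 - 1"
  have u: "0 < u" "u < 1"
    using real_sqrt_less_mono[of 1 2] real_sqrt_less_mono[of 2 4] by (auto simp: u_def)
  \<comment> \<open>The second conjunct makes the induction work: \<open>D\<close> need not be closed under multiplication.\<close>
  have powers: "u ^ j \<in> D \<and> sqrt 2 * u ^ j \<in> D" for j
  proof (induction j)
    case (Suc j)
    then have 1: "sqrt 2 * u ^ j - u ^ j \<in> D"
      by (blast intro: diff)
    then have "u ^ j - (sqrt 2 * u ^ j - u ^ j) \<in> D"
      using Suc by (blast intro: diff)
    moreover have "sqrt 2 * u ^ j - u ^ j = u ^ Suc j"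
      by (simp add: u_def algebra_simps)
    moreover have "u ^ j - (sqrt 2 * u ^ j - u ^ j) = sqrt 2 * u ^ Suc j"
      by (simp add: u_def algebra_simps)
    ultimately show ?case
      using 1 by simp
  qed (use assms in auto)
  from \<open>e > 0\<close> u obtain j where "u ^ j < e"
    using real_arch_pow_inv by blast
  with powers u(1) show "\<exists>d\<in>D. 0 < d \<and> d < e"
    by (intro bexI[of _ "u ^ j"]) auto
qed auto

section \<open>A dense subgroup with \<open>n + 1\<close> generators\<close>

lemma block_mat_translation_sum:
  assumes H: "subgroup H Gn" and "finite A" "\<And>k. k \<in> A \<Longrightarrow> block_mat 1 (f k) \<in> H"
  shows "block_mat 1 (\<Sum>k\<in>A. f k) \<in> H"
  using assms(2,3)
proof (induction A rule: finite_induct)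
  case empty
  then show ?case
    using subgroup.one_closed[OF H] by (simp add: Gn_one)
next
  case (insert k A)
  then show ?case
    using subgroup_Gn_mult[OF H, of 1 "f k" 1 "\<Sum>k\<in>A. f k"] by simp
qed

lemma tendsto_block_mat:
  assumes "(f \<longlongrightarrow> a) F" "(g \<longlongrightarrow> b) F"
  shows "((\<lambda>x. block_mat (f x) (g x)) \<longlongrightarrow> block_mat a b) F"
  unfolding block_mat_def
  by (intro tendsto_vec_lambda) (auto split: option.split intro!: assms tendsto_intros)

text \<open>In a subgroup containing \<open>(2, 0)\<close>, the commutator of that element with \<open>(a, e)\<close> is the
  translation by \<open>e\<close>.\<close>

lemma translation_from_commutator:
  assumes H: "subgroup H Gn" and "block_mat 2 0 \<in> H" "block_mat a e \<in> H"
  shows "block_mat 1 e \<in> H"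
proof -
  have "a > 0"
    using subgroup.mem_carrier[OF H assms(3)] by (simp add: block_mat_in_carrier_iff)
  have "block_mat (2 * a) (2 *\<^sub>R e) \<in> H"
    using subgroup_Gn_mult[OF H assms(2,3)] by simp
  moreover have "block_mat (a * 2) e \<in> H"
    using subgroup_Gn_mult[OF H assms(3,2)] by simp
  ultimately have "block_mat (2 * a * (1 / (a * 2)))
      (2 *\<^sub>R e + (2 * a) *\<^sub>R (- ((1 / (a * 2)) *\<^sub>R e))) \<in> H"
    by (intro subgroup_Gn_mult[OF H] subgroup_Gn_inv[OF H])
  moreover have "2 *\<^sub>R e + (2 * a) *\<^sub>R (- ((1 / (a * 2)) *\<^sub>R e)) = e"
    using \<open>a > 0\<close> by (simp add: scaleR_2)
  ultimately show ?thesis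
    using \<open>a > 0\<close> by simp
qed

lemma dense_translations:
  assumes H: "subgroup H Gn" and two: "block_mat 2 0 \<in> H" and e: "block_mat 1 e \<in> H"
  shows "closure {d. block_mat 1 (d *\<^sub>R e) \<in> H} = UNIV"
proof (rule dense_additive_group_halving)
  show "0 \<in> {d. block_mat 1 (d *\<^sub>R e) \<in> H}"
    using subgroup.one_closed[OF H] by (simp add: Gn_one)
next
  fix x y assume "x \<in> {d. block_mat 1 (d *\<^sub>R e) \<in> H}" "y \<in> {d. block_mat 1 (d *\<^sub>R e) \<in> H}"
  then show "x - y \<in> {d. block_mat 1 (d *\<^sub>R e) \<in> H}"
    using subgroup_Gn_translation_diff[OF H] by (simp add: scaleR_diff_left)
next
  fix x assume "x \<in> {d. block_mat 1 (d *\<^sub>R e) \<in> H}"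
  then have "block_mat 1 (x *\<^sub>R e) \<in> H"
    by simp
  from subgroup_Gn_mult[OF H subgroup_Gn_mult[OF H subgroup_Gn_inv[OF H two] this] two]
  show "x / 2 \<in> {d. block_mat 1 (d *\<^sub>R e) \<in> H}"
    by simp
qed (use e in simp)

lemma dense_dilations:
  assumes H: "subgroup H Gn" and two: "block_mat 2 0 \<in> H" and s: "block_mat (2 powr sqrt 2) 0 \<in> H"
  shows "closure {t. block_mat (2 powr t) 0 \<in> H} = UNIV"
proof (rule dense_additive_group_sqrt2)
  show "0 \<in> {t. block_mat (2 powr t) 0 \<in> H}"
    using subgroup.one_closed[OF H] by (simp add: Gn_one)
next
  fix x y assume "x \<in> {t. block_mat (2 powr t) 0 \<in> H}" "y \<in> {t. block_mat (2 powr t) 0 \<in> H}"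
  then have "block_mat (2 powr x) 0 \<in> H" "block_mat (2 powr y) 0 \<in> H"
    by simp_all
  from subgroup_Gn_mult[OF H this(1) subgroup_Gn_inv[OF H this(2)]]
  show "x - y \<in> {t. block_mat (2 powr t) 0 \<in> H}"
    by (simp add: powr_diff)
qed (use two s in simp_all)

lemma dense_subgroup:
  fixes H :: "(real ^ ('n::finite option) ^ ('n option)) set"
  assumes H: "subgroup H Gn" and two: "block_mat 2 0 \<in> H"
    and e: "\<And>k :: 'n. block_mat (2 powr sqrt 2) (axis k 1) \<in> H"
  shows "carrier Gn \<subseteq> closure H"
proof
  fix x :: "real ^ ('n option) ^ ('n option)" assume "x \<in> carrier Gn"
  then obtain a b where x: "x = block_mat a b" "a > 0"
    by (rule carrier_GnE)
  have trans: "block_mat 1 (axis k 1) \<in> H" for k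
    using translation_from_commutator[OF H two e] .
  have "block_mat (2 powr sqrt 2) 0 \<in> H"
  proof -
    fix k :: 'n
    have "block_mat 1 (- axis k 1) \<in> H"
      using subgroup_Gn_inv[OF H trans] by simp
    from subgroup_Gn_mult[OF H this e[of k]] show ?thesis
      by simp
  qed
  then have "log 2 a \<in> closure {t. block_mat (2 powr t) 0 \<in> H}"
    by (simp add: dense_dilations[OF H two])
  then obtain t where t: "\<And>m. block_mat (2 powr t m) 0 \<in> H" "t \<longlonglongrightarrow> log 2 a"
    by (auto simp: closure_sequential)
  have "\<exists>d. (\<forall>m. block_mat 1 (d m *\<^sub>R axis k 1) \<in> H) \<and> d \<longlonglongrightarrow> b $ k" for k
  proof -
    have "b $ k \<in> closure {d. block_mat 1 (d *\<^sub>R axis k 1) \<in> H}"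
      by (simp add: dense_translations[OF H two trans])
    then show ?thesis
      by (auto simp: closure_sequential)
  qed
  then obtain d where d: "\<And>k m. block_mat 1 (d k m *\<^sub>R axis k 1) \<in> H" "\<And>k. d k \<longlonglongrightarrow> b $ k"
    by metis
  have "block_mat (2 powr t m) (\<chi> k. d k m) \<in> H" for m
  proof -
    have "(\<Sum>k\<in>UNIV. d k m *\<^sub>R axis k 1) = (\<chi> k. d k m)"
      by (simp add: vec_eq_iff axis_def if_distrib cong: if_cong)
    moreover have "block_mat 1 (\<Sum>k\<in>UNIV. d k m *\<^sub>R axis k 1) \<in> H"
      using d(1) by (intro block_mat_translation_sum[OF H]) auto
    ultimately show ?thesis
      using subgroup_Gn_mult[OF H _ t(1)] by fastforce
  qed
  moreover have "(\<lambda>m. block_mat (2 powr t m) (\<chi> k. d k m)) \<longlonglongrightarrow> x"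
  proof -
    have "(\<lambda>m. 2 powr t m) \<longlonglongrightarrow> 2 powr log 2 a"
      by (intro tendsto_powr tendsto_const t(2)) simp
    moreover have "(\<lambda>m. \<chi> k. d k m) \<longlonglongrightarrow> (\<chi> k. b $ k)"
      by (intro tendsto_vec_lambda d(2))
    ultimately show ?thesis
      using x by (simp add: tendsto_block_mat)
  qed
  ultimately show "x \<in> closure H"
    unfolding closure_sequential
    by (intro exI[of _ "\<lambda>m. block_mat (2 powr t m) (\<chi> k. d k m)"]) simp
qed

lemma generators_exist:
  "\<exists>S :: (real ^ ('n::finite option) ^ ('n option)) set.
     S \<subseteq> carrier Gn \<and> finite S \<and> card S = CARD('n) + 1 \<and> generates_densely S"
proof -
  define T :: "(real ^ ('n option) ^ ('n option)) set"
    where "T = range (\<lambda>k. block_mat (2 powr sqrt 2) (axis k 1))"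
  define S where "S = insert (block_mat 2 0) T"
  have "card T = CARD('n)"
    unfolding T_def by (intro card_image injI) (simp add: block_mat_eq_iff axis_eq_axis)
  moreover have "block_mat 2 0 \<notin> T"
    by (auto simp: T_def block_mat_eq_iff axis_eq_0_iff)
  moreover have "finite T"
    by (simp add: T_def)
  ultimately have card: "finite S" "card S = CARD('n) + 1"
    by (simp_all add: S_def)
  have S: "S \<subseteq> carrier Gn"
    by (auto simp: S_def T_def block_mat_in_carrier_iff)
  have H: "subgroup (generate Gn S) Gn"
    using S by (rule group.generate_is_subgroup[OF group_Gn])
  have "carrier Gn \<subseteq> closure (generate Gn S)"
    by (rule dense_subgroup[OF H]) (auto intro!: generate.incl simp: S_def T_def)
  moreover have "generate Gn S \<subseteq> carrier Gn"
    using subgroup.subset[OF H] .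
  ultimately have "generates_densely S"
    by (auto simp: generates_densely_def closure_of_subtopology Int_absorb1)
  with S card show ?thesis
    by blast
qed

theorem proposition4p3:
  shows "(\<exists>S :: (real ^ ('n::finite option) ^ ('n option)) set.
            S \<subseteq> carrier Gn \<and> finite S \<and> card S = CARD('n) + 1 \<and> generates_densely S) \<and>
         (\<forall>S :: (real ^ ('n option) ^ ('n option)) set.
            S \<subseteq> carrier Gn \<and> finite S \<and> generates_densely S \<longrightarrow> CARD('n) + 1 \<le> card S)"
  using generators_exist card_generators_ge by blast

end
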